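(* Let $f\in A$ satisfy $$\mathrm{Re}\,\frac{2zf'(z)+z^2f''(z)}{f(z)+zf'(z)}>0,\qquad z\in E.$$ Then $f$ is starlike univalent in $E$, i.e. $f$ is univalent in $E$ and $f(E)$ is starlike with respect to the origin (equivalently, $\mathrm{Re}\,\frac{zf'(z)}{f(z)}>0$ for $z\in E$).
   Context: $E=\{z\in\mathbb{C}:|z|<1\}$ and $A$ is the class of analytic functions on $E$ of the form $f(z)=z+\sum_{k\ge2}a_kz^k$. Quotients of functions vanishing at $z=0$ are understood at $z=0$ as their limits. *)

theory Defs
  imports "HOL-Complex_Analysis.Complex_Analysis"
begin

abbreviation unit_disc :: "complex set" where
  "unit_disc \<equiv> ball 0 1"

definition class_A :: "(complex \<Rightarrow> complex) set" where
  "class_A = {f. f analytic_on unit_disc \<and>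
     (\<exists>a :: nat \<Rightarrow> complex. \<forall>z\<in>unit_disc. (\<lambda>k. a (k + 2) * z ^ (k + 2)) sums (f z - z))}"

text \<open>
  The quotient of two functions vanishing at the origin, with its value at the origin taken to be
  the limit. Away from the origin, the convention \<open>x / 0 = 0\<close> is harmless in a condition of the
  form \<open>Re (lim_quotient p q z) > 0\<close>: that condition forces \<open>q z \<noteq> 0\<close>.
\<close>
definition lim_quotient :: "(complex \<Rightarrow> complex) \<Rightarrow> (complex \<Rightarrow> complex) \<Rightarrow> complex \<Rightarrow> complex" where
  "lim_quotient p q z = (if z = 0 then Lim (at 0) (\<lambda>w. p w / q w) else p z / q z)"

text \<open>The library predicate \<^const>\<open>starlike\<close> leaves the centre existentially quantified.\<close>
definition starlike_wrt :: "complex \<Rightarrow> complex set \<Rightarrow> bool" where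
  "starlike_wrt c S \<longleftrightarrow> c \<in> S \<and> (\<forall>w\<in>S. closed_segment c w \<subseteq> S)"

end

theory Submission
  imports Defs
begin

text \<open>
  Write \<open>f(z) = z F(z)\<close> and \<open>g(z) = f(z) + z f'(z) = z G(z)\<close>, where \<open>G = 2F + z F'\<close>. Since
  \<open>z g' = 2 z f' + z\<^sup>2 f''\<close>, the hypothesis says that \<open>Re (z g'/g) > 0\<close>. As \<open>g = (z f)'\<close>, the
  function \<open>f\<close> is, up to a factor \<open>2\<close>, the Libera transform of \<open>g\<close>, and the assertion is that this
  transform preserves starlikeness.

  To see that \<open>Re (z f'/f) > 0\<close> (\<open>Libera_starlike\<close>), one uses the Cayley transform
  \<open>w = (z f' - f) / (z f' + f) = z F'/G\<close> of \<open>z f'/f\<close>. The denominator \<open>G\<close> has no zeros, since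
  \<open>G(0) = 2\<close> and a positive real part of \<open>z g'/g\<close> forces \<open>g \<noteq> 0\<close> elsewhere. So \<open>w\<close> is
  holomorphic before anything is known about the zeros of \<open>f\<close>, and \<open>|w| < 1\<close> yields at
  once that \<open>F\<close> has no zeros and that \<open>Re (z f'/f) > 0\<close>. If \<open>|w| < 1\<close> fails, there is a point \<open>a\<close> with
  \<open>|w(a)| = 1\<close> and \<open>|w| \<le> 1\<close> on the closed disc of radius \<open>|a|\<close> (\<open>first_exit_point\<close>). There
  \<open>a w'(a) = k w(a)\<close> with real \<open>k \<ge> 0\<close>, which is the weak form of Jack's lemma given by
  \<open>derivative_at_maximum_modulus_point\<close>. The identity
  \<open>(z g'/g) (1 - w) = 1 + w + z w'\<close> then contradicts \<open>Re (z g'/g) > 0\<close>.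

  Univalence and starlikeness (\<open>starlike_univalent_criterion\<close>) follow from \<open>Re (z f'/f) > 0\<close> by
  passing to logarithmic coordinates. With \<open>F = exp \<circ> q\<close>, the function \<open>\<Phi>(s) = s + q(exp s)\<close> on the
  left half-plane satisfies \<open>exp (\<Phi> s) = f(exp s)\<close>, and \<open>\<Phi>'\<close> is \<open>z f'/f\<close> at \<open>z = exp s\<close>. The
  half-plane being convex, all difference quotients of \<open>\<Phi>\<close> have positive real part. Hence
  \<open>f(y) = t f(x)\<close> with \<open>0 < t \<le> 1\<close> forces \<open>|y| \<le> |x|\<close>, and \<open>y = x\<close> if \<open>t = 1\<close>
  (\<open>starlike_radial_comparison\<close>). The bound \<open>|y| \<le> |x|\<close> confines the preimages of the segment from
  \<open>0\<close> to \<open>f(x)\<close> to a compact disc, and a connectedness argument shows that the segment is covered.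
\<close>

section \<open>Derivatives with positive real part and maximum modulus points\<close>

text \<open>
  The Noshiro--Warschawski argument: the difference quotient is the mean of \<open>\<Phi>'\<close> along the segment
  from \<open>x\<close> to \<open>y\<close>. The sign matters for the radial comparison, beyond the injectivity of \<open>\<Phi>\<close>.
\<close>
lemma Re_difference_quotient_pos:
  assumes "convex S" and x: "x \<in> S" and y: "y \<in> S" and "x \<noteq> y"
    and der: "\<And>z. z \<in> S \<Longrightarrow> (\<Phi> has_field_derivative \<Phi>' z) (at z)"
    and pos: "\<And>z. z \<in> S \<Longrightarrow> Re (\<Phi>' z) > 0"
  shows "Re ((\<Phi> y - \<Phi> x) / (y - x)) > 0"
proof -
  define G where "G = (\<lambda>t. \<Phi> (x + t * (y - x)) / (y - x))"
  have on_segment: "x + of_real t * (y - x) \<in> S" if "0 \<le> t" "t \<le> 1" for t :: real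
    using convexD_alt[OF \<open>convex S\<close> x y that] by (simp add: scaleR_conv_of_real algebra_simps)
  have G': "((\<lambda>t. Re (G (of_real t))) has_real_derivative Re (\<Phi>' (x + of_real t * (y - x)))) (at t)"
    if "0 \<le> t" "t \<le> 1" for t :: real
    unfolding G_def
    by (rule has_field_derivative_Re has_vector_derivative_real_field)+
       (use \<open>x \<noteq> y\<close> in \<open>auto intro!: derivative_eq_intros DERIV_chain2[where f = \<Phi>] der on_segment that\<close>)
  obtain t where "0 < t" "t < 1"
    "Re (G (of_real 1)) - Re (G (of_real 0)) = (1 - 0) * Re (\<Phi>' (x + of_real t * (y - x)))"
    using MVT2[OF zero_less_one G'] by blast
  then show ?thesis
    using pos[OF on_segment[of t]] by (simp add: G_def diff_divide_distrib)
qed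

text \<open>
  A weak form of Jack's lemma. Along the circle through \<open>a\<close> the modulus is stationary at \<open>a\<close>, so the
  product is real; along the radius it is largest at the end point \<open>a\<close>, so the product is nonnegative.
  When \<open>w a \<noteq> 0\<close> the conclusion says that \<open>a w' / w a\<close> is real and nonnegative.
\<close>
lemma derivative_at_maximum_modulus_point:
  assumes der: "(w has_field_derivative w') (at a)"
    and max: "\<And>z. norm z \<le> norm a \<Longrightarrow> norm (w z) \<le> norm (w a)"
  obtains k :: real where "k \<ge> 0" "cnj (w a) * (a * w') = of_real k"
proof -
  \<comment> \<open>\<open>c = 1\<close> moves along the radius and \<open>c = \<i>\<close> along the circle. Projecting onto the direction of
    \<open>w a\<close> avoids differentiating a modulus.\<close>
  define u where "u c t = Re (cnj (w a) * w (a * exp (of_real t * c)))" for c and t :: real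
  have u': "(u c has_real_derivative Re (cnj (w a) * (a * w' * c))) (at 0)" for c
    unfolding u_def
    by (rule has_field_derivative_Re has_vector_derivative_real_field)+
       (use der in \<open>auto intro!: derivative_eq_intros DERIV_chain2[where f = w]\<close>)
  have u_max: "u c t \<le> u c 0" if "Re (of_real t * c) \<le> 0" for c t
  proof -
    have "norm (a * exp (of_real t * c)) \<le> norm a"
      using that by (simp add: norm_mult mult_left_le)
    from max[OF this] have "norm (cnj (w a) * w (a * exp (of_real t * c))) \<le> (norm (w a))\<^sup>2"
      by (simp add: norm_mult power2_eq_square mult_left_mono)
    also have "(norm (w a))\<^sup>2 = u c 0"
      by (simp add: u_def complex_norm_square[symmetric] mult.commute[of "cnj _"]
            del: of_real_power flip: of_real_power)
    finally show ?thesis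
      unfolding u_def using complex_Re_le_cmod order_trans by blast
  qed
  have "Re (cnj (w a) * (a * w' * \<i>)) = 0"
    by (rule DERIV_local_max[OF u' zero_less_one]) (use u_max[where c = \<i>] in simp)
  then have im: "Im (cnj (w a) * (a * w')) = 0"
    by (simp add: algebra_simps)
  have re: "Re (cnj (w a) * (a * w')) \<ge> 0"
  proof (rule ccontr)
    assume "\<not> ?thesis"
    then have "Re (cnj (w a) * (a * w' * 1)) < 0"
      by simp
    from DERIV_neg_dec_left[OF u' this] obtain d
      where "d > 0" "\<forall>h>0. h < d \<longrightarrow> u 1 0 < u 1 (0 - h)" by blast
    then have "u 1 0 < u 1 (- (d/2))" 
      by (metis diff_0 field_sum_of_halves half_gt_zero less_add_same_cancel1)
    moreover have "u 1 (- (d/2)) \<le> u 1 0"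
      by (rule u_max) (use \<open>d > 0\<close> in simp)
    ultimately show False by simp
  qed
  from im re show ?thesis
    by (intro that[of "Re (cnj (w a) * (a * w'))"]) (auto simp: complex_eq_iff)
qed


text \<open>
  A point of least modulus at which \<open>|w| \<ge> 1\<close> does the job: inside its circle \<open>|w| < 1\<close>, hence
  \<open>|w| \<le> 1\<close> on the circle by continuity.
\<close>
lemma first_exit_point:
  fixes w :: "complex \<Rightarrow> complex"
  assumes cont: "continuous_on (ball 0 r) w" and w0: "norm (w 0) < 1"
    and z: "z \<in> ball 0 r" "norm (w z) \<ge> 1"
  obtains a where "a \<in> ball 0 r" "norm (w a) = 1"
    "\<And>z. norm z \<le> norm a \<Longrightarrow> norm (w z) \<le> 1"
proof -
  define S where "S = {y \<in> cball 0 (norm z). norm (w y) \<ge> 1}"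
  have sub: "cball 0 (norm z) \<subseteq> ball 0 r"
    using z by auto
  have "closed S"
    unfolding S_def
    by (intro continuous_on_closed_Collect_le continuous_intros continuous_on_subset[OF cont sub])
       auto
  then have "compact S"
    unfolding S_def by (metis (no_types, lifting) bounded_cball bounded_subset compact_eq_bounded_closed mem_Collect_eq subsetI)
  moreover have "z \<in> S"
    using z by (simp add: S_def)
  ultimately obtain a where a: "a \<in> S" and a_min: "\<And>y. y \<in> S \<Longrightarrow> norm a \<le> norm y"
    using continuous_attains_inf[of S norm] continuous_on_norm_id by blast
  have "a \<noteq> 0"
    using a w0 by (auto simp: S_def)
  have "norm a \<le> norm z"
    using a by (simp add: S_def)
  have inside: "norm (w y) \<le> 1" if "y \<in> ball 0 (norm a)" for y
    using a_min[of y] that \<open>norm a \<le> norm z\<close> by (force simp: S_def)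
  have le: "norm (w y) \<le> 1" if "norm y \<le> norm a" for y
  proof (rule continuous_on_closure_norm_le[where s = "ball 0 (norm a)" and f = w])
    show "continuous_on (closure (ball 0 (norm a))) w"
      using \<open>a \<noteq> 0\<close> \<open>norm a \<le> norm z\<close> sub by (auto intro!: continuous_on_subset[OF cont])
  qed (use inside that \<open>a \<noteq> 0\<close> in auto)
  show ?thesis
  proof (rule that)
    show "a \<in> ball 0 r"
      using a subsetD[OF sub, of a] by (simp add: S_def)
    show "norm (w a) = 1"
      using a le[of a] by (simp add: S_def)
  qed (rule le)
qed

section \<open>The Libera transform preserves starlikeness\<close>

text \<open>
  With \<open>f = z F\<close> and \<open>g = z G\<close> the second equation means \<open>g = f + z f'\<close>, and the real parts are those
  of \<open>z g'/g\<close> and \<open>z f'/f\<close>. Dividing out the zero at the origin in advance spares any case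
  distinction there.
\<close>
lemma Libera_starlike:
  assumes F: "F holomorphic_on unit_disc"
    and G: "\<And>z. z \<in> unit_disc \<Longrightarrow> G z = 2 * F z + z * deriv F z"
    and G_nz: "\<And>z. z \<in> unit_disc \<Longrightarrow> G z \<noteq> 0"
    and G_starlike: "\<And>z. z \<in> unit_disc \<Longrightarrow> Re (1 + z * deriv G z / G z) > 0"
    and z: "z \<in> unit_disc"
  shows "F z \<noteq> 0" "Re (1 + z * deriv F z / F z) > 0"
proof -
  \<comment> \<open>This is \<open>(p - 1) / (p + 1)\<close> for \<open>p = 1 + z F'/F\<close>, cleared of the possible zeros of \<open>F\<close>.\<close>
  define w where "w = (\<lambda>z. z * deriv F z / G z)"
  have "G holomorphic_on unit_disc"
    by (subst holomorphic_cong[OF refl G]) (auto intro!: holomorphic_intros F)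
  then have w: "w holomorphic_on unit_disc"
    unfolding w_def using G_nz by (intro holomorphic_intros F) auto
  have wG: "z * deriv F z = w z * G z" if "z \<in> unit_disc" for z
    using G_nz[OF that] by (simp add: w_def)
  have F_eq: "F z = G z * (1 - w z) / 2" if "z \<in> unit_disc" for z
    using G[OF that] wG[OF that] by (simp add: algebra_simps)
  have w_lt: "norm (w z) < 1" if z: "z \<in> unit_disc" for z
  proof (rule ccontr)
    assume "\<not> norm (w z) < 1"
    then obtain a where a: "a \<in> unit_disc" and wa: "norm (w a) = 1"
      and max: "\<And>z. norm z \<le> norm a \<Longrightarrow> norm (w z) \<le> 1"
      using first_exit_point[OF holomorphic_on_imp_continuous_on[OF w] _ z]
      by (auto simp: w_def linorder_not_less)
    have w': "(w has_field_derivative deriv w a) (at a)"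
      and G': "(G has_field_derivative deriv G a) (at a)"
      using w \<open>G holomorphic_on unit_disc\<close> a by (auto intro: holomorphic_derivI)
    obtain k where k: "k \<ge> 0" "cnj (w a) * (a * deriv w a) = of_real k"
      using derivative_at_maximum_modulus_point[OF w'] max wa by metis
    have "w a * cnj (w a) = 1"
      using wa complex_norm_square[of "w a"] by simp
    then have k_eq: "a * deriv w a = of_real k * w a"
      using k(2) by (metis mult.assoc mult.commute mult_1)
    \<comment> \<open>Comparing the derivative of \<open>F = G (1 - w) / 2\<close> with \<open>z F' = w G\<close> relates \<open>G'/G\<close> to \<open>w\<close>.\<close>
    have "((\<lambda>z. G z * (1 - w z) / 2) has_field_derivative
        (deriv G a * (1 - w a) - G a * deriv w a) / 2) (at a)"
      by (auto intro!: derivative_eq_intros w' G')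
    then have "(F has_field_derivative (deriv G a * (1 - w a) - G a * deriv w a) / 2) (at a)"
      by (rule has_field_derivative_transform_within_open[of _ _ _ unit_disc])
         (use a F_eq in auto)
    then have deriv_F: "deriv F a = (deriv G a * (1 - w a) - G a * deriv w a) / 2"
      by (rule DERIV_imp_deriv)
    have "2 * (a * deriv F a) = a * deriv G a * (1 - w a) - G a * (a * deriv w a)"
      unfolding deriv_F by (simp add: field_simps)
    then have "2 * w a = (a * deriv G a / G a) * (1 - w a) - a * deriv w a"
      using G_nz[OF a] by (simp add: w_def field_simps)
    moreover define Q where "Q = 1 + a * deriv G a / G a"
    ultimately have Q: "Q * (1 - w a) = 1 + (1 + of_real k) * w a"
      unfolding k_eq by (simp add: algebra_simps)
    show False
    proof (cases "w a = 1")
      case True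
      with Q have "Re (1 + (1 + of_real k)) = 0"
        by (metis diff_self mult_zero_right mult_1_right zero_complex.simps(1))
      with \<open>k \<ge> 0\<close> show False by simp
    next
      case False
      \<comment> \<open>Multiplying by the conjugate of \<open>1 - w a\<close> exposes the sign of the real part of \<open>Q\<close>.\<close>
      have "Q * of_real ((norm (1 - w a))\<^sup>2)
          = (1 + (1 + of_real k) * w a) * cnj (1 - w a)"
        unfolding Q[symmetric] by (simp add: complex_norm_square mult.assoc del: of_real_power)
      also have "\<dots> = 1 - cnj (w a) + (1 + of_real k) * (w a - 1)"
        using \<open>w a * cnj (w a) = 1\<close> by (simp add: algebra_simps)
      finally have "Re (Q * of_real ((norm (1 - w a))\<^sup>2))
          = Re (1 - cnj (w a) + (1 + of_real k) * (w a - 1))"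
        by (rule arg_cong)
      then have "Re Q * (norm (1 - w a))\<^sup>2 = k * (Re (w a) - 1)"
        by (simp add: algebra_simps del: of_real_power)
      moreover have "k * (Re (w a) - 1) \<le> 0"
        using \<open>k \<ge> 0\<close> complex_Re_le_cmod[of "w a"] wa by (simp add: mult_nonneg_nonpos)
      moreover have "Re Q * (norm (1 - w a))\<^sup>2 > 0"
        using G_starlike[OF a] False unfolding Q_def by (intro mult_pos_pos) auto
      ultimately show False by linarith
    qed
  qed
  have "1 - w z \<noteq> 0"
    using w_lt[OF z] by auto
  then show F_nz: "F z \<noteq> 0"
    unfolding F_eq[OF z] using G_nz[OF z] by simp
  have "1 + z * deriv F z / F z = (1 + w z) / (1 - w z)"
    unfolding wG[OF z] F_eq[OF z] using G_nz[OF z] \<open>1 - w z \<noteq> 0\<close>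
    by (simp add: divide_simps)
  also have "\<dots> = (1 + w z) * cnj (1 - w z) / of_real ((norm (1 - w z))\<^sup>2)"
    by (rule complex_div_cnj)
  also have "Re \<dots> = (1 - (norm (w z))\<^sup>2) / (norm (1 - w z))\<^sup>2"
    unfolding cmod_power2[of "w z"]
    by (simp add: Re_divide_of_real algebra_simps power2_eq_square del: of_real_power)
  also have "\<dots> > 0"
    using abs_square_less_1[of "norm (w z)"] w_lt[OF z] \<open>1 - w z \<noteq> 0\<close>
    by (intro divide_pos_pos) auto
  finally show "Re (1 + z * deriv F z / F z) > 0" .
qed

section \<open>The analytic criterion for starlike univalent functions\<close>

text \<open>
  In the coordinate \<open>s\<close> with \<open>z = exp s\<close>, scaling \<open>z F z\<close> by \<open>t\<close> is the translation of \<open>\<Phi>\<close> by the real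
  number \<open>ln t \<le> 0\<close>. As difference quotients of \<open>\<Phi>\<close> have positive real part, such a translation
  cannot increase \<open>Re s\<close>, which is \<open>ln |z|\<close>.
\<close>
lemma starlike_radial_comparison:
  assumes F: "F holomorphic_on unit_disc"
    and F_nz: "\<And>z. z \<in> unit_disc \<Longrightarrow> F z \<noteq> 0"
    and pos: "\<And>z. z \<in> unit_disc \<Longrightarrow> Re (1 + z * deriv F z / F z) > 0"
    and x: "x \<in> unit_disc" "x \<noteq> 0" and y: "y \<in> unit_disc" "y \<noteq> 0"
    and t: "0 < t" "t \<le> 1"
    and eq: "y * F y = of_real t * (x * F x)"
  shows "norm y \<le> norm x" "t = 1 \<Longrightarrow> y = x"
proof -
  obtain q where q: "q holomorphic_on unit_disc" and F_exp: "\<And>z. z \<in> unit_disc \<Longrightarrow> F z = exp (q z)"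
    using contractible_imp_holomorphic_log[OF F convex_imp_contractible[OF convex_ball] F_nz] by blast
  define \<Phi> where "\<Phi> s = s + q (exp s)" for s
  have \<Phi>_exp: "exp (\<Phi> s) = exp s * F (exp s)" if "exp s \<in> unit_disc" for s
    by (simp add: \<Phi>_def exp_add F_exp[OF that])
  have \<Phi>': "(\<Phi> has_field_derivative 1 + exp s * deriv F (exp s) / F (exp s)) (at s)"
    if "exp s \<in> unit_disc" for s
  proof -
    have q': "(q has_field_derivative deriv q (exp s)) (at (exp s))"
      using q that by (auto intro: holomorphic_derivI)
    have "(F has_field_derivative exp (q (exp s)) * deriv q (exp s)) (at (exp s))"
      by (rule has_field_derivative_transform_within_open[of "\<lambda>z. exp (q z)" _ _ unit_disc])
         (use that F_exp in \<open>auto intro!: derivative_eq_intros q'\<close>)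
    then have "deriv F (exp s) = F (exp s) * deriv q (exp s)"
      using F_exp[OF that] by (simp add: DERIV_imp_deriv)
    then have "exp s * deriv F (exp s) / F (exp s) = deriv q (exp s) * exp s"
      using F_nz[OF that] by simp
    then show ?thesis
      unfolding \<Phi>_def by (auto intro!: derivative_eq_intros DERIV_chain2[where f = q] q')
  qed
  define a where "a = Ln x"
  have a: "exp a = x" 
    using x by (simp add: a_def)
  have "exp (\<Phi> (Ln y)) = exp (\<Phi> a + of_real (ln t))"
    using x y t eq a \<Phi>_exp[of a] \<Phi>_exp[of "Ln y"] by (simp add: exp_add exp_of_real mult.commute)
  then obtain n where n: "\<Phi> (Ln y) = \<Phi> a + of_real (ln t) + of_int (2 * n) * of_real pi * \<i>"
    unfolding exp_eq by auto
  \<comment> \<open>\<open>\<Phi>\<close> commutes with translation by \<open>2 \<pi> \<i>\<close>, so another logarithm of \<open>y\<close> absorbs the period.\<close>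
  define b where "b = Ln y - of_int (2 * n) * of_real pi * \<i>"
  have "exp b = exp (Ln y)"
    unfolding exp_eq by (rule exI[of _ "- n"]) (simp add: b_def)
  then have b: "exp b = y"
    using y by simp
  then have diff: "\<Phi> b - \<Phi> a = of_real (ln t)"
    using n y by (simp add: \<Phi>_def) (simp add: b_def algebra_simps)
  have key: "Re (of_real (ln t) / (b - a)) > 0" if "a \<noteq> b"
    unfolding diff[symmetric]
  proof (rule Re_difference_quotient_pos[OF convex_halfspace_Re_lt[of 0]])
    show "(\<Phi> has_field_derivative 1 + exp s * deriv F (exp s) / F (exp s)) (at s)"
      "Re (1 + exp s * deriv F (exp s) / F (exp s)) > 0"
      if "s \<in> {s. Re s < 0}" for s
      using that \<Phi>'[of s] pos[of "exp s"] by simp_all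
    have "norm (exp a) < 1" "norm (exp b) < 1"
      using a b x y by simp_all
    then show "a \<in> {s. Re s < 0}" "b \<in> {s. Re s < 0}"
      by auto
  qed fact
  show "y = x" if "t = 1"
    using key that a b by auto
  have "Re b \<le> Re a"
  proof (rule ccontr)
    assume *: "\<not> ?thesis"
    then have "Re (of_real (ln t) / (b - a)) = ln t * (Re (b - a) / (norm (b - a))\<^sup>2)"
      by (simp add: Re_divide cmod_power2)
    also have "\<dots> \<le> 0"
      using * t by (intro mult_nonpos_nonneg) auto
    finally show False
      using key * by force
  qed
  then show "norm y \<le> norm x"
    unfolding a[symmetric] b[symmetric] by simp
qed

text \<open>
  On the segment from \<open>0\<close> to \<open>f x\<close>, the values taken by \<open>f\<close> on the open disc are already taken on the
  compact disc of radius \<open>|x|\<close>. So they form a subset of the segment that is both relatively open, by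
  the open mapping theorem, and closed.
\<close>
lemma starlike_univalent_criterion:
  assumes F: "F holomorphic_on unit_disc"
    and F_nz: "\<And>z. z \<in> unit_disc \<Longrightarrow> F z \<noteq> 0"
    and pos: "\<And>z. z \<in> unit_disc \<Longrightarrow> Re (1 + z * deriv F z / F z) > 0"
  defines "f \<equiv> \<lambda>z. z * F z"
  shows "inj_on f unit_disc" "starlike_wrt 0 (f ` unit_disc)"
proof -
  note compare = starlike_radial_comparison[OF F F_nz pos]
  have f0: "f z = 0 \<longleftrightarrow> z = 0" if "z \<in> unit_disc" for z
    using F_nz[OF that] by (simp add: f_def)
  have f: "f holomorphic_on unit_disc"
    unfolding f_def by (intro holomorphic_intros F)
  show inj: "inj_on f unit_disc"
  proof (rule inj_onI)
    fix x y assume xy: "x \<in> unit_disc" "y \<in> unit_disc" "f x = f y"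
    show "x = y"
    proof (cases "x = 0 \<or> y = 0")
      case True
      with xy f0 show ?thesis by metis
    next
      case False
      with xy compare(2)[of y x 1] show ?thesis by (simp add: f_def)
    qed
  qed
  have "closed_segment 0 (f x) \<subseteq> f ` unit_disc" if x: "x \<in> unit_disc" for x
  proof -
    let ?L = "closed_segment 0 (f x)"
    have sub: "cball 0 (norm x) \<subseteq> unit_disc"
      using x by auto
    have same: "?L \<inter> f ` unit_disc = ?L \<inter> f ` cball 0 (norm x)"
    proof (rule antisym; rule subsetI)
      fix v assume v: "v \<in> ?L \<inter> f ` unit_disc"
      then obtain y t where y: "y \<in> unit_disc" "v = f y" and t: "0 \<le> t" "t \<le> 1" "f y = of_real t * f x"
        by (fastforce simp: in_segment scaleR_conv_of_real)
      have "norm y \<le> norm x"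
      proof (cases "y = 0")
        case False
        then have "x \<noteq> 0" "t \<noteq> 0"
          using t f0[OF y(1)] f0[OF x] by auto
        with False t x y compare(1)[of x y t] show ?thesis
          by (simp add: f_def)
      qed simp
      with v y show "v \<in> ?L \<inter> f ` cball 0 (norm x)" by auto
    qed (use sub in auto)
    have "open (f ` unit_disc)"
      using open_mapping_thm3[OF f _ inj] by simp
    then have "openin (top_of_set ?L) (?L \<inter> f ` unit_disc)"
      by (rule openin_open_Int)
    moreover have "compact (f ` cball 0 (norm x))"
      by (intro compact_continuous_image continuous_on_subset[OF _ sub]
            holomorphic_on_imp_continuous_on[OF f]) auto
    then have "closedin (top_of_set ?L) (?L \<inter> f ` unit_disc)"
      unfolding same by (intro closedin_closed_Int compact_imp_closed)
    moreover have "f x \<in> ?L \<inter> f ` unit_disc"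
      using x by simp
    ultimately have "?L \<inter> f ` unit_disc = ?L"
      using connected_segment(1)[of 0 "f x"] unfolding connected_clopen by blast
    then show ?thesis by blast
  qed
  then show "starlike_wrt 0 (f ` unit_disc)"
    using f0[of 0] by (force simp: starlike_wrt_def image_iff)
qed

section \<open>Functions in the class A\<close>

lemma class_A_divide_by_argument:
  assumes "f \<in> class_A"
  obtains F where "F holomorphic_on unit_disc" "F 0 = 1" "\<And>z. z \<in> unit_disc \<Longrightarrow> f z = z * F z"
proof -
  obtain a where a: "\<And>z. z \<in> unit_disc \<Longrightarrow> (\<lambda>k. a (k + 2) * z ^ (k + 2)) sums (f z - z)"
    and "f analytic_on unit_disc"
    using assms unfolding class_A_def by blast
  then have f: "f holomorphic_on unit_disc"
    using analytic_imp_holomorphic by blast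
  define c where "c n = (if n = 0 then 0 else if n = 1 then 1 else a n)" for n
  have c: "(\<lambda>n. c n * z ^ n) sums f z" if "norm z < 1" for z
    using a[of z] that sums_iff_shift[of "\<lambda>n. c n * z ^ n" 2 "f z - z"]
    by (simp add: c_def numeral_2_eq_2)
  have "f 0 = 0"
    using c[of 0] by (simp add: c_def)
  have "(f has_field_derivative deriv f 0) (at 0)"
    using f by (auto intro: holomorphic_derivI)
  from termdiffs_sums_strong[OF c this] have "deriv f 0 = 1"
    by (simp add: diffs_def c_def)
  show ?thesis
  proof (rule that)
    show "(\<lambda>z. if z = 0 then deriv f 0 else (f z - f 0) / (z - 0)) holomorphic_on unit_disc"
      by (rule pole_lemma_open[OF f open_ball])
  qed (use \<open>f 0 = 0\<close> \<open>deriv f 0 = 1\<close> in auto)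
qed

lemma deriv_mult_argument:
  assumes H: "H holomorphic_on unit_disc" and h: "\<And>z. z \<in> unit_disc \<Longrightarrow> h z = z * H z"
    and z: "z \<in> unit_disc"
  shows "deriv h z = H z + z * deriv H z"
proof (rule DERIV_imp_deriv, rule has_field_derivative_transform_within_open[of _ _ _ unit_disc])
  have "(H has_field_derivative deriv H z) (at z)"
    using H z by (auto intro: holomorphic_derivI)
  then show "((\<lambda>z. z * H z) has_field_derivative H z + z * deriv H z) (at z)"
    by (auto intro!: derivative_eq_intros)
qed (use z h in auto)

theorem corollary2:
  fixes f :: "complex \<Rightarrow> complex"
  assumes "f \<in> class_A"
    and "\<And>z. z \<in> unit_disc \<Longrightarrow>
      Re (lim_quotient (\<lambda>w. 2 * w * deriv f w + w ^ 2 * deriv (deriv f) w)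
                       (\<lambda>w. f w + w * deriv f w) z) > 0"
  shows "inj_on f unit_disc \<and> starlike_wrt 0 (f ` unit_disc) \<and>
    (\<forall>z\<in>unit_disc. Re (lim_quotient (\<lambda>w. w * deriv f w) f z) > 0)"
proof -
  obtain F where F: "F holomorphic_on unit_disc" and "F 0 = 1"
    and f_eq: "\<And>z. z \<in> unit_disc \<Longrightarrow> f z = z * F z"
    using class_A_divide_by_argument[OF assms(1)] by blast
  have f': "deriv f z = F z + z * deriv F z" if "z \<in> unit_disc" for z
    by (rule deriv_mult_argument[OF F _ that]) (rule f_eq)
  define G where "G = (\<lambda>z. 2 * F z + z * deriv F z)"
  define g where "g = (\<lambda>z. f z + z * deriv f z)"
  have G: "G holomorphic_on unit_disc"
    unfolding G_def by (intro holomorphic_intros F) auto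
  have g_eq: "g z = z * G z" if "z \<in> unit_disc" for z
    using that by (simp add: g_def G_def f_eq[OF that] f'[OF that] algebra_simps)
  have f: "f holomorphic_on unit_disc"
    by (subst holomorphic_cong[OF refl f_eq]) (auto intro!: holomorphic_intros F)
  have g': "2 * z * deriv f z + z ^ 2 * deriv (deriv f) z = z * deriv g z" if z: "z \<in> unit_disc" for z
  proof -
    have "(f has_field_derivative deriv f z) (at z)"
      "(deriv f has_field_derivative deriv (deriv f) z) (at z)"
      using f z by (auto intro!: holomorphic_derivI[of _ unit_disc] holomorphic_deriv)
    then have "(g has_field_derivative 2 * deriv f z + z * deriv (deriv f) z) (at z)"
      unfolding g_def by (auto intro!: derivative_eq_intros)
    then show ?thesis
      by (simp add: DERIV_imp_deriv power2_eq_square algebra_simps)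
  qed
  have G_starlike: "G z \<noteq> 0 \<and> Re (1 + z * deriv G z / G z) > 0" if z: "z \<in> unit_disc" for z
  proof (cases "z = 0")
    case True
    with \<open>F 0 = 1\<close> show ?thesis by (simp add: G_def)
  next
    case False
    have "Re (z * deriv g z / g z) > 0"
      using assms(2)[OF z] False g'[OF z] by (simp add: lim_quotient_def g_def)
    moreover have "deriv g z = G z + z * deriv G z"
      by (rule deriv_mult_argument[OF G _ z]) (rule g_eq)
    ultimately have "Re ((G z + z * deriv G z) / G z) > 0"
      using False by (simp add: g_eq[OF z])
    moreover from this have "G z \<noteq> 0" by auto
    ultimately show ?thesis by (simp add: add_divide_distrib)
  qed
  have F_nz: "F z \<noteq> 0" and F_starlike: "Re (1 + z * deriv F z / F z) > 0" if "z \<in> unit_disc" for z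
    using Libera_starlike[OF F _ _ _ that, of G] G_starlike by (auto simp: G_def)
  have "f ` unit_disc = (\<lambda>z. z * F z) ` unit_disc"
    using f_eq by (rule image_cong[OF refl])
  moreover have "inj_on f unit_disc \<longleftrightarrow> inj_on (\<lambda>z. z * F z) unit_disc"
    using f_eq by (rule inj_on_cong)
  ultimately have "inj_on f unit_disc" "starlike_wrt 0 (f ` unit_disc)"
    using starlike_univalent_criterion[OF F F_nz F_starlike] by simp_all
  moreover have "Re (lim_quotient (\<lambda>w. w * deriv f w) f z) > 0" if z: "z \<in> unit_disc" for z
  proof -
    \<comment> \<open>The value at the origin is the limit of the quotient, which \<open>?p\<close> extends continuously.\<close>
    let ?p = "\<lambda>z. 1 + z * deriv F z / F z"
    have quot: "y * deriv f y / f y = ?p y" if "y \<in> unit_disc" "y \<noteq> 0" for y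
      using that F_nz[of y] by (simp add: f_eq[OF that(1)] f'[OF that(1)] field_simps)
    have "?p holomorphic_on unit_disc"
      by (intro holomorphic_intros F F_nz) auto
    then have "isCont ?p 0"
      by (metis centre_in_ball continuous_on_interior holomorphic_on_imp_continuous_on
          interior_open open_ball zero_less_one)
    then have "(?p \<longlongrightarrow> ?p 0) (at 0)"
      by (simp only: isCont_def)
    then have "((\<lambda>y. y * deriv f y / f y) \<longlongrightarrow> ?p 0) (at 0)"
      by (rule Lim_transform_within_open[of _ _ _ _ unit_disc]) (use quot in auto)
    then have "lim_quotient (\<lambda>w. w * deriv f w) f z = ?p z"
      using quot[OF z] by (auto simp: lim_quotient_def dest: tendsto_Lim[rotated])
    then show ?thesis
      using F_starlike[OF z] by simp
  qed
  ultimately show ?thesis by blast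
qed

end
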